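(* Let $L$ be an orthomodular lattice, $\theta$ a congruence on $L$, $I=[0]\theta$ and $a\in L$. Then (i) $[a]\theta=I+_l a$, (ii) $I=[a]\theta+_l a$. In particular, these formulas provide bijections between the congruence classes: $i\mapsto i+_l a$ is a bijection from $I$ onto $[a]\theta$, and $x\mapsto x+_l a$ is a bijection from $[a]\theta$ onto $I$.
   Context: An orthomodular lattice (OML) is an algebra $(L,\lor,\land,',0,1)$ such that $(L,\lor,\land,0,1)$ is a bounded lattice, $'$ is an orthocomplementation ($x\land x'=0$, $x\lor x'=1$, $x''=x$, and $x\le y$ implies $y'\le x'$), and the orthomodular law holds: $x\le y$ implies $y=x\lor(y\land x')$. The operation $+_l$ is defined by $x+_l y:=(x\lor(x'\land y))\land(x'\lor y')$; for $S\subseteq L$ and $a\in L$, $S+_l a:=\{s+_l a\mid s\in S\}$. Congruences are congruences of the algebra $(L,\lor,\land,',0,1)$, and $[a]\theta$ denotes the $\theta$-class of $a$. *)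

theory Defs
  imports "HOL-Library.Complemented_Lattices"
begin

unbundle lattice_syntax

(* In the class orthomodular_lattice, - x is the orthocomplement x'.  The class also carries
   a binary minus, but it is fixed to be x \<sqinter> - y, so it adds no structure. *)

definition add_l :: "'a::orthomodular_lattice \<Rightarrow> 'a \<Rightarrow> 'a"  (infixl "+\<^sub>l" 65)
  where "x +\<^sub>l y = (x \<squnion> (- x \<sqinter> y)) \<sqinter> (- x \<squnion> - y)"

(* The constants \<bottom> and \<top> impose no condition on a congruence beyond reflexivity. *)
definition oml_congruence :: "'a::orthomodular_lattice rel \<Rightarrow> bool"
  where "oml_congruence \<theta> \<longleftrightarrow>
    equiv UNIV \<theta> \<and>
    (\<forall>x y u v. (x, y) \<in> \<theta> \<longrightarrow> (u, v) \<in> \<theta> \<longrightarrow> (x \<squnion> u, y \<squnion> v) \<in> \<theta>) \<and>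
    (\<forall>x y u v. (x, y) \<in> \<theta> \<longrightarrow> (u, v) \<in> \<theta> \<longrightarrow> (x \<sqinter> u, y \<sqinter> v) \<in> \<theta>) \<and>
    (\<forall>x y. (x, y) \<in> \<theta> \<longrightarrow> (- x, - y) \<in> \<theta>)"

end

theory Submission
  imports Defs
begin

text \<open>
  Right translation \<open>x \<mapsto> x +\<^sub>l a\<close> is an involution of the lattice
  (\<open>add_l_cancel_right\<close>), it is compatible with every congruence
  (\<open>oml_congruence_add_l\<close>), and it exchanges \<open>\<bottom>\<close> and \<open>a\<close>.  Hence it maps the
  class of \<open>\<bottom>\<close> into the class of \<open>a\<close> and the class of \<open>a\<close> into the class of \<open>\<bottom>\<close>,
  and these two maps are mutually inverse.

  The involution property is the heart of the matter.  Distributivity fails in general, but the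
  orthomodular law yields the instance \<open>inf_sup_distrib_orthogonal\<close>.  It turns \<open>x +\<^sub>l a\<close> into an
  orthogonal join \<open>r \<squnion> p\<close>, where \<open>r = x \<sqinter> - (x \<sqinter> a)\<close> is the part of \<open>x\<close> left over by
  \<open>q = x \<sqinter> a\<close>, and \<open>p = - x \<sqinter> a\<close>.  Translation by \<open>a\<close> keeps \<open>r\<close> and replaces \<open>q\<close> by \<open>p\<close>;
  doing so once more brings \<open>q\<close> back, so that the outcome is \<open>r \<squnion> q = x\<close>.
\<close>

text \<open>The dual of the orthomodular law: an orthogonal join can be undone by a meet.\<close>

lemma sup_inf_compl_orthogonal:
  fixes r p :: "'a::orthomodular_lattice"
  assumes "p \<le> - r"
  shows "(r \<squnion> p) \<sqinter> - p = r"
proof -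
  have "r \<le> - p"
    using assms by (metis compl_mono ortho_involution)
  then have "- r = p \<squnion> (- p \<sqinter> - r)"
    using orthomodular[OF assms] by simp
  then have "r = - (p \<squnion> (- p \<sqinter> - r))"
    by (metis ortho_involution)
  then show ?thesis
    by (simp add: inf_commute sup_commute)
qed

text \<open>
  A Foulis-Holland type instance of distributivity.  The right-hand side lies below the left-hand
  side, and the meet of the left-hand side with the complement of the right-hand side vanishes,
  because \<open>(r \<squnion> p) \<sqinter> - p\<close> collapses to \<open>r\<close>; the orthomodular law then forces equality.
\<close>

lemma inf_sup_distrib_orthogonal:
  fixes r p b :: "'a::orthomodular_lattice"
  assumes "p \<le> b" and "p \<le> - r"
  shows "(r \<squnion> p) \<sqinter> b = (r \<sqinter> b) \<squnion> p"
proof -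
  let ?u = "(r \<sqinter> b) \<squnion> p" and ?v = "(r \<squnion> p) \<sqinter> b"
  have "?u \<le> ?v"
    using assms(1) by (simp add: le_infI1 le_supI1)
  moreover have "- ?u \<sqinter> ?v = \<bottom>"
  proof -
    have "- ?u \<sqinter> ?v = - (r \<sqinter> b) \<sqinter> (((r \<squnion> p) \<sqinter> - p) \<sqinter> b)"
      by (simp only: compl_sup inf_assoc inf_left_commute inf_commute)
    also have "\<dots> = \<bottom>"
      by (simp only: sup_inf_compl_orthogonal[OF assms(2)] inf_compl_bot_left1 compl_inf_bot)
    finally show ?thesis .
  qed
  ultimately show ?thesis
    using orthomodular[of ?u ?v] by simp
qed

lemma add_l_eq_sup:
  fixes x a :: "'a::orthomodular_lattice"
  shows "x +\<^sub>l a = (x \<sqinter> - (x \<sqinter> a)) \<squnion> (- x \<sqinter> a)"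
proof -
  have "- x \<sqinter> a \<le> - (x \<sqinter> a)"
    by (simp add: le_infI1 le_supI1)
  then show ?thesis
    using inf_sup_distrib_orthogonal[of "- x \<sqinter> a" "- (x \<sqinter> a)" x]
    by (simp add: add_l_def)
qed

text \<open>
  The second translation meets \<open>a\<close> only in \<open>p\<close> and leaves exactly \<open>q\<close> of \<open>a\<close> outside
  \<open>x +\<^sub>l a\<close>, so \<open>p\<close> and \<open>q\<close> trade places again.
\<close>

lemma add_l_cancel_right:
  fixes x a :: "'a::orthomodular_lattice"
  shows "x +\<^sub>l a +\<^sub>l a = x"
proof -
  define p q r z where "p = - x \<sqinter> a" and "q = x \<sqinter> a" and "r = x \<sqinter> - q" and "z = x +\<^sub>l a"
  have z: "z = r \<squnion> p"
    by (simp add: z_def r_def p_def q_def add_l_eq_sup)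
  have p_r: "p \<le> - r" and p_q: "q \<le> - p"
    by (simp_all add: p_def r_def q_def le_infI1 le_supI1)
  have "z \<sqinter> a = (r \<sqinter> a) \<squnion> p"
    unfolding z by (rule inf_sup_distrib_orthogonal[OF _ p_r]) (simp add: p_def)
  also have "r \<sqinter> a = q \<sqinter> - q"
    by (simp only: r_def q_def inf_assoc inf_left_commute inf_commute)
  finally have z_a: "z \<sqinter> a = p"
    by simp
  have "- z \<sqinter> a = - p \<sqinter> ((- x \<squnion> q) \<sqinter> a)"
    by (simp add: z r_def inf_assoc inf_left_commute inf_commute)
  also have "(- x \<squnion> q) \<sqinter> a = p \<squnion> q"
    using inf_sup_distrib_orthogonal[of q a "- x"] by (simp add: q_def p_def)
  also have "- p \<sqinter> (p \<squnion> q) = q"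
    using sup_inf_compl_orthogonal[of p q] p_q
    by (metis compl_mono inf_commute ortho_involution sup_commute)
  finally have mz_a: "- z \<sqinter> a = q" .
  have "z +\<^sub>l a = (z \<sqinter> - p) \<squnion> q"
    by (simp only: add_l_eq_sup z_a mz_a)
  also have "z \<sqinter> - p = r"
    unfolding z by (rule sup_inf_compl_orthogonal[OF p_r])
  also have "r \<squnion> q = x"
    using orthomodular[of q x] by (simp add: r_def q_def inf_commute sup_commute)
  finally show ?thesis
    by (simp add: z_def)
qed

lemma add_l_bot_left: "\<bottom> +\<^sub>l a = a"
  by (simp add: add_l_def)

lemma add_l_self: "a +\<^sub>l a = \<bottom>"
  by (simp add: add_l_def)

lemma oml_congruence_add_l:
  assumes "oml_congruence \<theta>" and "(x, y) \<in> \<theta>"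
  shows "(x +\<^sub>l a, y +\<^sub>l a) \<in> \<theta>"
proof -
  have "(a, a) \<in> \<theta>"
    using assms(1) by (simp add: oml_congruence_def equiv_def refl_on_def)
  then show ?thesis
    using assms by (simp add: oml_congruence_def add_l_def)
qed

theorem theorem20:
  fixes \<theta> :: "'a::orthomodular_lattice rel" and I :: "'a set" and a :: 'a
  assumes "oml_congruence \<theta>"
    and "I = \<theta> `` {\<bottom>}"
  shows "\<theta> `` {a} = {i +\<^sub>l a | i. i \<in> I} \<and>
         I = {x +\<^sub>l a | x. x \<in> \<theta> `` {a}} \<and>
         bij_betw (\<lambda>i. i +\<^sub>l a) I (\<theta> `` {a}) \<and>
         bij_betw (\<lambda>x. x +\<^sub>l a) (\<theta> `` {a}) I"
proof -
  let ?t = "\<lambda>x. x +\<^sub>l a"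
  have I_to_class: "?t ` I \<subseteq> \<theta> `` {a}"
    using oml_congruence_add_l[OF assms(1), of \<bottom> _ a] assms(2)
    by (auto simp: add_l_bot_left)
  have class_to_I: "?t ` (\<theta> `` {a}) \<subseteq> I"
    using oml_congruence_add_l[OF assms(1), of a _ a] assms(2)
    by (auto simp: add_l_self)
  have bij: "bij_betw ?t I (\<theta> `` {a})" "bij_betw ?t (\<theta> `` {a}) I"
    using I_to_class class_to_I
    by (auto intro!: bij_betw_byWitness[where f' = ?t] simp: add_l_cancel_right)
  then have "?t ` I = \<theta> `` {a}" "?t ` (\<theta> `` {a}) = I"
    by (auto simp: bij_betw_def)
  then show ?thesis
    using bij by (auto simp: Setcompr_eq_image)
qed

end
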